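(* Let $k \geq 1$ be an integer and let $G$ be a connected graph of order $n \geq 2$. Then $\gamma_{k}^t(G) \geq \frac{1}{k}\mathrm{rad}(G)$.
   Context: All graphs are finite and simple; $d_G(u,v)$ is the length of a shortest $(u,v)$-path in $G$, and for $S \subseteq V(G)$, $d_G(v,S)=\min_{w\in S} d_G(v,w)$. The eccentricity of $v$ is $\mathrm{ecc}_G(v)=\max_{w} d_G(v,w)$ and the radius $\mathrm{rad}(G)$ is the minimum eccentricity over all vertices. For an integer $k\ge 1$ and a graph $G$ without isolated vertices, a set $S\subseteq V(G)$ is a total $k$-dominating set of $G$ if $d_G(v, S\setminus\{v\}) \le k$ for every $v \in V(G)$; the total $k$-domination number $\gamma_k^t(G)$ is the minimum cardinality of such a set. *)

theory Defs
  imports "Graph_Theory.Graph_Theory"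
begin

text \<open>
  A finite simple graph is a \<^term>\<open>graph\<close> of the library, i.e. a finite digraph without loops
  or parallel arcs whose arc relation is symmetric: each edge is a pair of opposite arcs. Hence the
  arc paths from \<open>u\<close> to \<open>v\<close> are the \<open>(u,v)\<close>-paths of the undirected graph, with the same length.
\<close>

text \<open>
  The distance is the library's shortest path cost for unit arc costs. It takes values in
  \<^typ>\<open>ereal\<close>, so it is \<open>\<infinity>\<close> between different components. The library takes the infimum over
  walks; \<open>graph_dist_eq_INF_apath\<close> and \<open>graph_dist_attained\<close> show that it is the length of a
  shortest path.
\<close>

definition graph_dist :: "('a, 'b) pre_digraph \<Rightarrow> 'a \<Rightarrow> 'a \<Rightarrow> ereal" where
  "graph_dist G u v = wf_digraph.\<mu> G (\<lambda>_. 1) u v"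

text \<open>The distance to the empty set is \<open>\<infinity>\<close>.\<close>

definition dist_to_set :: "('a, 'b) pre_digraph \<Rightarrow> 'a \<Rightarrow> 'a set \<Rightarrow> ereal" where
  "dist_to_set G v S = (INF w\<in>S. graph_dist G v w)"

definition eccentricity :: "('a, 'b) pre_digraph \<Rightarrow> 'a \<Rightarrow> ereal" where
  "eccentricity G v = (SUP w\<in>verts G. graph_dist G v w)"

definition radius :: "('a, 'b) pre_digraph \<Rightarrow> ereal" where
  "radius G = (INF v\<in>verts G. eccentricity G v)"

definition total_dominating_set :: "nat \<Rightarrow> ('a, 'b) pre_digraph \<Rightarrow> 'a set \<Rightarrow> bool" where
  "total_dominating_set k G S \<longleftrightarrow>
     S \<subseteq> verts G \<and> (\<forall>v\<in>verts G. dist_to_set G v (S - {v}) \<le> ereal (real k))"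

text \<open>
  Meaningful for \<open>k \<ge> 1\<close> and graphs without isolated vertices, where the whole vertex set is a
  total \<open>k\<close>-dominating set, so that the minimum is over a nonempty finite set.
\<close>

definition total_domination_number :: "nat \<Rightarrow> ('a, 'b) pre_digraph \<Rightarrow> nat" where
  "total_domination_number k G = Min (card ` {S. total_dominating_set k G S})"

lemma (in wf_digraph) awalk_cost_unit: "awalk_cost (\<lambda>_. 1) p = real (length p)"
  by (induct p) auto

lemma (in wf_digraph) graph_dist_eq_INF_apath:
  "graph_dist G u v = (INF p\<in>{p. apath u p v}. ereal (real (length p)))"
proof (rule antisym)
  show "graph_dist G u v \<le> (INF p\<in>{p. apath u p v}. ereal (real (length p)))"
    unfolding graph_dist_def \<mu>_def
    by (rule INF_superset_mono) (auto simp: apath_def awalk_cost_unit)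
next
  show "(INF p\<in>{p. apath u p v}. ereal (real (length p))) \<le> graph_dist G u v"
    unfolding graph_dist_def \<mu>_def
  proof (rule INF_mono)
    fix p assume "p \<in> {p. awalk u p v}"
    then have p: "awalk u p v" by simp
    have "awalk_cost (\<lambda>_. 1) (awalk_to_apath p) \<le> awalk_cost (\<lambda>_. 1) p"
      using p pos_cost_pos_awalk_cost[where c = "\<lambda>_. 1"]
      by (intro awalk_to_path_no_neg_cyc_cost) (auto simp: not_less)
    then show "\<exists>q\<in>{p. apath u p v}. ereal (real (length q)) \<le> ereal (awalk_cost (\<lambda>_. 1) p)"
      using apath_awalk_to_apath[OF p] by (auto simp: awalk_cost_unit)
  qed
qed

lemma (in wf_digraph) graph_dist_attained:
  assumes "u \<rightarrow>\<^sup>*\<^bsub>G\<^esub> v"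
  obtains p where "apath u p v" "graph_dist G u v = ereal (real (length p))"
    "\<And>q. apath u q v \<Longrightarrow> length p \<le> length q"
proof -
  obtain p0 where "apath u p0 v" using assms reachable_apath by blast
  then obtain p where p: "apath u p v" and
    min: "\<And>q. apath u q v \<Longrightarrow> length p \<le> length q"
    using ex_has_least_nat[of "\<lambda>p. apath u p v" p0 length] by blast
  have "graph_dist G u v = ereal (real (length p))"
    unfolding graph_dist_eq_INF_apath
    by (rule antisym) (auto intro!: INF_lower2[of p] INF_greatest simp: p min)
  with p min show ?thesis using that by blast
qed

lemma (in graph) total_dominating_set_verts:
  assumes "k \<ge> 1" and no_isolated: "\<And>v. v \<in> verts G \<Longrightarrow> \<exists>w. v \<rightarrow>\<^bsub>G\<^esub> w"
  shows "total_dominating_set k G (verts G)"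
  unfolding total_dominating_set_def
proof (intro conjI ballI)
  fix v assume "v \<in> verts G"
  then obtain w where "v \<rightarrow>\<^bsub>G\<^esub> w" using no_isolated by blast
  then obtain e where e: "e \<in> arcs G" "tail G e = v" "head G e = w"
    by (auto simp: arcs_ends_def arc_to_ends_def)
  then have w: "w \<in> verts G - {v}" using no_loops[OF e(1)] by auto
  have "awalk v [e] w" using e by (auto simp: awalk_def)
  then have "graph_dist G v w \<le> ereal 1"
    unfolding graph_dist_def by (drule_tac min_cost_le_walk_cost[where c="\<lambda>_. 1"])
      (simp add: awalk_cost_unit)
  also have "\<dots> \<le> ereal (real k)" using assms(1) by simp
  finally show "dist_to_set G v (verts G - {v}) \<le> ereal (real k)"
    unfolding dist_to_set_def using w by (blast intro: INF_lower2)
qed simp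

lemma (in graph) total_domination_number_attained:
  assumes "k \<ge> 1" and "\<And>v. v \<in> verts G \<Longrightarrow> \<exists>w. v \<rightarrow>\<^bsub>G\<^esub> w"
  obtains S where "total_dominating_set k G S" "card S = total_domination_number k G"
    "\<And>T. total_dominating_set k G T \<Longrightarrow> card S \<le> card T"
proof -
  let ?A = "{S. total_dominating_set k G S}"
  have "?A \<subseteq> Pow (verts G)" by (auto simp: total_dominating_set_def)
  then have fin: "finite ?A" by (rule finite_subset) simp
  have ne: "?A \<noteq> {}" using total_dominating_set_verts[OF assms] by blast
  obtain S where S: "S \<in> ?A" "card S = Min (card ` ?A)"
    using Min_in[of "card ` ?A"] fin ne by fastforce
  show ?thesis
    by (rule that[of S]) (use S fin in \<open>auto simp: total_domination_number_def\<close>)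
qed

end

theory Submission
  imports Defs
begin

text \<open>
  Grow a subset \<open>A\<close> of a total \<open>k\<close>-dominating set \<open>S\<close>. If some vertex of \<open>S - A\<close> is within \<open>k\<close> of
  \<open>A\<close>, add it at the cost of a path of length \<open>k\<close>. Otherwise some \<open>x \<in> S - A\<close> is within \<open>2k + 1\<close> of
  \<open>A\<close>, and \<open>x\<close> has a partner within \<open>k\<close> which is also outside \<open>A\<close>: both are added at cost
  \<open>3k + 1\<close>. Hence \<open>S\<close> lies in a subtree of size \<open>W\<close> with \<open>2W \<le> (3k + 1) |S| - 4k - 2\<close>. The centre
  of the subtree is within \<open>(W + 1) / 2\<close> of \<open>S\<close>, so its eccentricity is at most
  \<open>(W + 1) / 2 + k \<le> (3k + 1) |S| / 4 \<le> k |S|\<close>. The subtree itself is never needed: it suffices to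
  track its centre.
\<close>

section \<open>Centres of sets in an integer-valued metric with geodesics\<close>

locale nat_geodesic_space =
  fixes V :: "'a set" and d :: "'a \<Rightarrow> 'a \<Rightarrow> nat"
  assumes dist_refl: "x \<in> V \<Longrightarrow> d x x = 0"
    and dist_sym: "x \<in> V \<Longrightarrow> y \<in> V \<Longrightarrow> d x y = d y x"
    and dist_triangle: "x \<in> V \<Longrightarrow> y \<in> V \<Longrightarrow> z \<in> V \<Longrightarrow> d x z \<le> d x y + d y z"
    and geodesic: "x \<in> V \<Longrightarrow> y \<in> V \<Longrightarrow> i \<le> d x y
      \<Longrightarrow> \<exists>z\<in>V. d x z = i \<and> d z y = d x y - i"
begin

text \<open>
  A tree of diameter \<open>W\<close> has a centre, which is a vertex if \<open>W\<close> is even and an edge if \<open>W\<close> is odd.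
\<close>

definition centred :: "nat \<Rightarrow> 'a set \<Rightarrow> bool" where
  "centred W A \<longleftrightarrow> (\<exists>c\<in>V. \<exists>c'\<in>V. d c c' \<le> W mod 2 \<and>
     (\<forall>a\<in>A. d c a \<le> W div 2 \<or> d c' a \<le> W div 2))"

lemma centred_subset: "centred W B \<Longrightarrow> A \<subseteq> B \<Longrightarrow> centred W A"
  unfolding centred_def by blast

lemma centred_singleton: "x \<in> V \<Longrightarrow> centred 0 {x}"
  unfolding centred_def using dist_refl by auto

text \<open>Rounding up pays for crossing the central edge from \<open>c\<close> to
  \<open>c'\<close> when \<open>W\<close> is odd; for even \<open>W\<close> the two are at distance
  0.\<close>

lemma centred_ball:
  assumes "centred W A" "A \<subseteq> V"
  obtains c where "c \<in> V" "\<And>a. a \<in> A \<Longrightarrow> d c a \<le> (W + 1) div 2"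
proof -
  obtain c c' where c: "c \<in> V" "c' \<in> V" "d c c' \<le> W mod 2"
    and near: "\<And>a. a \<in> A \<Longrightarrow> d c a \<le> W div 2 \<or> d c' a \<le> W div 2"
    using assms(1) unfolding centred_def by blast
  have "d c a \<le> (W + 1) div 2" if "a \<in> A" for a
  proof -
    have "d c a \<le> d c c' + d c' a" using dist_triangle c that assms(2) by blast
    with near[OF that] c(3) show ?thesis by presburger
  qed
  with c that show ?thesis by blast
qed

text \<open>The centre moves by half an edge towards \<open>x\<close>: a central vertex becomes an
  edge, and a central edge contracts to its endpoint near \<open>y\<close>.\<close>

lemma centred_insert_neighbour:
  assumes "centred W A" "A \<subseteq> V" "y \<in> A" "x \<in> V" "d y x \<le> 1"
  shows "centred (Suc W) (insert x A)"
proof (cases "even W")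
  case True
  obtain c where c: "c \<in> V" and near: "\<And>a. a \<in> A \<Longrightarrow> d c a \<le> W div 2"
    using centred_ball[OF assms(1,2)] True by (metis Suc_eq_plus1 even_Suc_div_two)
  have "d c x \<le> Suc (W div 2)"
    using dist_triangle[of c y x] near[OF assms(3)] assms c by force
  \<comment> \<open>The first vertex after \<open>c\<close> on a geodesic to \<open>x\<close>; the
    minimum covers \<open>d c x = 0\<close>.\<close>
  moreover obtain z where "z \<in> V" "d c z = min 1 (d c x)" "d z x = d c x - min 1 (d c x)"
    using geodesic[of c x "min 1 (d c x)"] c assms(4) by auto
  ultimately show ?thesis
    unfolding centred_def using c near True
    by (intro bexI[of _ c] bexI[of _ z]) (auto simp: odd_iff_mod_2_eq_one)
next
  case False
  \<comment> \<open>By symmetry, \<open>c\<close> can name the endpoint of the central edge that is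
    near \<open>y\<close>.\<close>
  obtain c c' where c: "c \<in> V" "c' \<in> V" "d c c' \<le> W mod 2" "d c y \<le> W div 2"
    and near: "\<And>a. a \<in> A \<Longrightarrow> d c a \<le> W div 2 \<or> d c' a \<le> W div 2"
    using assms(1,3) dist_sym unfolding centred_def by metis
  have W: "Suc W div 2 = Suc (W div 2)" "W mod 2 = 1"
    using False by (simp_all add: odd_iff_mod_2_eq_one)
  have "d c a \<le> Suc (W div 2)" if "a \<in> A" for a
  proof -
    have "d c a \<le> d c c' + d c' a" using dist_triangle c that assms(2) by blast
    with near[OF that] c(3) W show ?thesis by linarith
  qed
  moreover have "d c x \<le> Suc (W div 2)"
    using dist_triangle[of c y x] c assms by force
  ultimately show ?thesis
    unfolding centred_def using c(1) dist_refl W by (intro bexI[of _ c]) auto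
qed

text \<open>Move along a geodesic from \<open>y\<close> to \<open>x\<close> one unit at a time,
  forgetting each intermediate vertex once its successor is added.\<close>

lemma centred_insert:
  assumes "centred W A" "A \<subseteq> V" "y \<in> A" "x \<in> V" "d y x \<le> w"
  shows "centred (W + w) (insert x A)"
  using assms(4,5)
proof (induction w arbitrary: x)
  case 0
  obtain c c' where c: "c \<in> V" "c' \<in> V" "d c c' \<le> W mod 2"
    and near: "\<And>a. a \<in> A \<Longrightarrow> d c a \<le> W div 2 \<or> d c' a \<le> W div 2"
    using assms(1) unfolding centred_def by blast
  have "d c x \<le> W div 2 \<or> d c' x \<le> W div 2"
    using near[OF assms(3)] dist_triangle[of c y x] dist_triangle[of c' y x] c 0 assms by force
  with c near show ?case unfolding centred_def by auto
next
  case (Suc w)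
  obtain z where z: "z \<in> V" "d y z = min w (d y x)" "d z x = d y x - min w (d y x)"
    using geodesic[of y x "min w (d y x)"] assms(2,3) Suc.prems by auto
  have "centred (W + w) (insert z A)" using Suc.IH z by simp
  then have "centred (Suc (W + w)) (insert x (insert z A))"
    by (rule centred_insert_neighbour[of _ _ z]) (use z Suc.prems assms(2) in auto)
  then show ?case by (auto elim: centred_subset)
qed

text \<open>Take a closest pair \<open>y\<close>, \<open>x\<close>. If it were farther apart, let
  \<open>s\<close> be within \<open>k\<close> of the point \<open>z\<close> at distance
  \<open>k + 1\<close> from \<open>y\<close>. Then either \<open>s\<close> is in \<open>A\<close>
  and closer to \<open>x\<close> than \<open>y\<close> is, or it is outside \<open>A\<close> and at
  most \<open>2 * k + 1\<close> from \<open>y\<close>.\<close>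

lemma dominating_set_link:
  assumes "S \<subseteq> V" and dom: "\<And>v. v \<in> V \<Longrightarrow> \<exists>s\<in>S. d v s \<le> k"
    and "A \<subseteq> S" "A \<noteq> {}" "A \<noteq> S"
  obtains y x where "y \<in> A" "x \<in> S - A" "d y x \<le> 2 * k + 1"
proof -
  let ?P = "\<lambda>(y, x). y \<in> A \<and> x \<in> S - A"
  obtain y0 x0 where "?P (y0, x0)" using assms by auto
  then obtain p where "?P p" "\<And>q. ?P q \<Longrightarrow> case_prod d p \<le> case_prod d q"
    using ex_has_least_nat[of ?P "(y0, x0)" "case_prod d"] by blast
  then obtain y x where yx: "y \<in> A" "x \<in> S - A"
    and min: "\<And>y' x'. y' \<in> A \<Longrightarrow> x' \<in> S - A \<Longrightarrow> d y x \<le> d y' x'"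
    by (cases p) fastforce
  have V: "x \<in> V" "y \<in> V" using yx assms by auto
  have "d y x \<le> 2 * k + 1"
  proof (rule ccontr)
    assume far: "\<not> ?thesis"
    then obtain z where z: "z \<in> V" "d y z = k + 1" "d z x = d y x - (k + 1)"
      using geodesic[of y x "k + 1"] V by auto
    obtain s where s: "s \<in> S" "d z s \<le> k" using dom z by blast
    have sV: "s \<in> V" using s assms by auto
    show False
    proof (cases "s \<in> A")
      case True
      then show False
        using min[of s x] yx dist_triangle[of s z x] dist_sym[of s z] s z sV V far by force
    next
      case False
      then show False
        using min[of y s] yx dist_triangle[of y z s] s z sV V far by force
    qed
  qed
  with yx that show ?thesis by blast
qed

lemma total_dominating_set_centred:
  assumes "finite S" "S \<subseteq> V" "S \<noteq> {}"
    and dom: "\<And>v. v \<in> V \<Longrightarrow> \<exists>s\<in>S - {v}. d v s \<le> k"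
  obtains W where "centred W S" "2 * W + 4 * k + 2 \<le> (3 * k + 1) * card S"
proof -
  \<comment> \<open>The budget is \<open>3 * k + 1\<close> per vertex for \<open>2 * W\<close>. The
    offset \<open>4 * k + 2\<close> makes it tight for a pair with \<open>W = k\<close>.\<close>
  define Q where "Q A \<longleftrightarrow> A \<subseteq> S \<and> A \<noteq> {} \<and>
    (\<exists>W. centred W A \<and> 2 * W + 4 * k + 2 \<le> (3 * k + 1) * card A)" for A
  obtain s where s: "s \<in> S" using assms by auto
  then obtain t where t: "t \<in> S - {s}" "d s t \<le> k" using dom assms by blast
  have "centred (0 + k) (insert t {s})"
    by (rule centred_insert[of _ _ s]) (use s t assms centred_singleton in auto)
  then have "Q {s, t}"
    unfolding Q_def using s t by (auto simp: insert_commute intro!: exI[of _ k])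
  moreover have "\<forall>A. Q A \<longrightarrow> card A < Suc (card S)"
    unfolding Q_def using assms(1) card_mono less_Suc_eq_le by blast
  ultimately obtain A where A: "Q A" and max: "\<And>B. Q B \<Longrightarrow> card B \<le> card A"
    using ex_has_greatest_nat[of Q "{s, t}" card "Suc (card S)"] by metis
  obtain W where AS: "A \<subseteq> S" "A \<noteq> {}" and W: "centred W A"
    "2 * W + 4 * k + 2 \<le> (3 * k + 1) * card A"
    using A unfolding Q_def by blast
  have AV: "A \<subseteq> V" and fin: "finite A" using AS assms(1,2) by (auto intro: finite_subset)
  \<comment> \<open>Otherwise adding \<open>x\<close> raises \<open>2 * W\<close> by
    \<open>2 * k\<close>, within the allowance of one vertex, against maximality.\<close>
  have apart: "k < d y x" if "y \<in> A" "x \<in> S - A" for y x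
  proof (rule ccontr)
    assume "\<not> ?thesis"
    then have "centred (W + k) (insert x A)"
      using that assms by (intro centred_insert[OF W(1) AV that(1)]) auto
    then have "Q (insert x A)"
      unfolding Q_def using W(2) that AS fin
      by (auto intro!: exI[of _ "W + k"])
    then show False using max[of "insert x A"] that fin by auto
  qed
  have "A = S"
  proof (rule ccontr)
    assume "A \<noteq> S"
    moreover have "\<exists>s\<in>S. d v s \<le> k" if "v \<in> V" for v using dom[OF that] by blast
    ultimately obtain y x where yx: "y \<in> A" "x \<in> S - A" "d y x \<le> 2 * k + 1"
      using dominating_set_link[OF assms(2)] AS by metis
    obtain t where t: "t \<in> S - {x}" "d x t \<le> k" using dom yx assms by blast
    \<comment> \<open>A partner in \<open>A\<close> would be within \<open>k\<close> of
      \<open>x\<close>, contradicting \<open>apart\<close>.\<close>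
    have tA: "t \<notin> A"
      using apart[of t x] yx t dist_sym[of t x] assms by force
    have "centred (W + (2 * k + 1)) (insert x A)"
      by (rule centred_insert[OF W(1) AV yx(1)]) (use yx assms in auto)
    then have "centred (W + (2 * k + 1) + k) (insert t (insert x A))"
      by (rule centred_insert[of _ _ x]) (use yx t assms AV in auto)
    moreover have card: "card (insert t (insert x A)) = card A + 2"
      using t yx tA fin by auto
    \<comment> \<open>Here \<open>2 * W\<close> grows by \<open>6 * k + 2\<close>, exactly the
      allowance of two vertices.\<close>
    ultimately have "Q (insert t (insert x A))"
      unfolding Q_def using W(2) yx t AS
      by (auto simp only: card intro!: exI[of _ "W + (2 * k + 1) + k"]) (auto simp: algebra_simps)
    then show False using max card by fastforce
  qed
  with W that show ?thesis by blast
qed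

lemma total_dominating_set_ball:
  assumes "finite S" "S \<subseteq> V" "V \<noteq> {}" "k \<ge> 1"
    and dom: "\<And>v. v \<in> V \<Longrightarrow> \<exists>s\<in>S - {v}. d v s \<le> k"
  obtains c where "c \<in> V" "\<And>v. v \<in> V \<Longrightarrow> d c v \<le> k * card S"
proof -
  have "S \<noteq> {}" using assms by fastforce
  then obtain W where W: "centred W S" "2 * W + 4 * k + 2 \<le> (3 * k + 1) * card S"
    using total_dominating_set_centred[OF assms(1,2) _ dom] by blast
  obtain c where c: "c \<in> V" "\<And>s. s \<in> S \<Longrightarrow> d c s \<le> (W + 1) div 2"
    using centred_ball[OF W(1) assms(2)] by blast
  \<comment> \<open>After division by 4, the offset \<open>4 * k + 2\<close> covers both the
    rounding of the radius and the last \<open>k\<close> steps from \<open>S\<close> to an arbitrary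
    vertex.\<close>
  have "(3 * k + 1) * card S \<le> 4 * (k * card S)" using assms(4) by (simp add: algebra_simps)
  then have W': "(W + 1) div 2 + k \<le> k * card S" using W(2) by linarith
  have "d c v \<le> k * card S" if v: "v \<in> V" for v
  proof -
    obtain s where s: "s \<in> S" "d v s \<le> k" using dom[OF v] by blast
    then show ?thesis
      using dist_triangle[of c s v] dist_sym[of s v] c v assms(2) W' by fastforce
  qed
  with c(1) that show ?thesis by blast
qed

end

section \<open>Graph distance as the least power of the arc relation\<close>

lemma (in wf_digraph) awalk_length_iff_relpow:
  "(\<exists>p. awalk u p v \<and> length p = n) \<longleftrightarrow> u \<in> verts G \<and> (u, v) \<in> arcs_ends G ^^ n"
proof (induction n arbitrary: u)
  case 0
  show ?case by (auto simp: awalk_def)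
next
  case (Suc n)
  have "(\<exists>p. awalk u p v \<and> length p = Suc n) \<longleftrightarrow>
      (\<exists>e. e \<in> arcs G \<and> u = tail G e \<and> (\<exists>p. awalk (head G e) p v \<and> length p = n))"
    by (auto simp: length_Suc_conv awalk_Cons_iff) (metis awalk_Cons_iff length_Cons)+
  then show ?case
    unfolding Suc.IH relpow.simps relpow_commute[symmetric]
    by (auto simp: arcs_ends_def arc_to_ends_def)
qed

text \<open>Powers compose additively, which gives the triangle inequality. For geodesics, cut a
  shortest chain after \<open>i\<close> steps: shortening either piece would shorten the
  whole.\<close>

lemma nat_geodesic_space_relpow:
  assumes "sym R" and conn: "\<And>x y. x \<in> V \<Longrightarrow> y \<in> V \<Longrightarrow> (x, y) \<in> R\<^sup>*"
    and closed: "R \<subseteq> V \<times> V"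
  shows "nat_geodesic_space V (\<lambda>x y. LEAST n. (x, y) \<in> R ^^ n)"
proof -
  let ?d = "\<lambda>x y. LEAST n. (x, y) \<in> R ^^ n"
  have le: "?d x y \<le> n" if "(x, y) \<in> R ^^ n" for x y n
    using that by (rule Least_le)
  have attained: "(x, y) \<in> R ^^ ?d x y" if "x \<in> V" "y \<in> V" for x y
    using conn[OF that] by (auto simp: rtrancl_power intro: LeastI_ex)
  have "sym (R ^^ n)" for n
  proof (induction n)
    case (Suc n)
    then show ?case
      using assms(1) unfolding sym_conv_converse_eq by (simp add: converse_relcomp relpow_commute)
  qed (simp add: sym_Id)
  then have sym_pow: "(y, x) \<in> R ^^ n \<longleftrightarrow> (x, y) \<in> R ^^ n" for x y n
    by (metis symD)
  show ?thesis
  proof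
    fix x assume "x \<in> V"
    show "?d x x = 0" using le[of x x 0] by simp
  next
    fix x y
    show "?d x y = ?d y x" by (simp add: sym_pow)
  next
    fix x y z assume "x \<in> V" "y \<in> V" "z \<in> V"
    then show "?d x z \<le> ?d x y + ?d y z"
      by (intro le) (auto simp: relpow_add intro: attained)
  next
    fix x y i assume xy: "x \<in> V" "y \<in> V" and i: "i \<le> ?d x y"
    then have "(x, y) \<in> R ^^ (i + (?d x y - i))" using attained by simp
    then obtain z where z: "(x, z) \<in> R ^^ i" "(z, y) \<in> R ^^ (?d x y - i)"
      unfolding relpow_add by blast
    have "(x, z) \<in> R\<^sup>*" using z(1) by (auto simp: rtrancl_power)
    then have zV: "z \<in> V" using closed xy(1) by (induction) auto
    have "(x, y) \<in> R ^^ (?d x z + ?d z y)"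
      unfolding relpow_add using attained xy zV by blast
    then have "?d x y \<le> ?d x z + ?d z y" by (rule le)
    moreover have "?d x z \<le> i" "?d z y \<le> ?d x y - i" using z by (auto intro: le)
    ultimately show "\<exists>z\<in>V. ?d x z = i \<and> ?d z y = ?d x y - i"
      using zV i by (intro bexI[of _ z]) linarith+
  qed
qed

lemma (in wf_digraph) graph_dist_eq_Least:
  assumes "u \<rightarrow>\<^sup>*\<^bsub>G\<^esub> v"
  shows "graph_dist G u v = ereal (real (LEAST n. (u, v) \<in> arcs_ends G ^^ n))"
proof -
  obtain p where p: "apath u p v" "graph_dist G u v = ereal (real (length p))"
    and min: "\<And>q. apath u q v \<Longrightarrow> length p \<le> length q"
    using graph_dist_attained[OF assms] by metis
  have u: "u \<in> verts G" using assms by (rule reachable_in_verts)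
  have "(LEAST n. (u, v) \<in> arcs_ends G ^^ n) = length p"
  proof (rule Least_equality)
    show "(u, v) \<in> arcs_ends G ^^ length p"
      using p(1) awalk_length_iff_relpow by (auto simp: apath_def)
  next
    fix n assume "(u, v) \<in> arcs_ends G ^^ n"
    then obtain q where q: "awalk u q v" "length q = n"
      using awalk_length_iff_relpow u by metis
    have "graph_dist G u v \<le> ereal (real n)"
      unfolding graph_dist_def
      using min_cost_le_walk_cost[OF q(1), of "\<lambda>_. 1"] q(2) by (simp add: awalk_cost_unit)
    then show "length p \<le> n" using p(2) by simp
  qed
  with p(2) show ?thesis by simp
qed

theorem theorem3p4:
  fixes G :: "('a, 'b) pre_digraph" and k :: nat
  assumes "k \<ge> 1"
    and "graph G"
    and "Digraph_Component.connected G"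
    and "card (verts G) \<ge> 2"
  shows "ereal (real (total_domination_number k G)) \<ge> ereal (1 / real k) * radius G"
proof -
  interpret graph G by fact
  let ?d = "\<lambda>u v. LEAST n. (u, v) \<in> arcs_ends G ^^ n"
  have reach: "u \<rightarrow>\<^sup>*\<^bsub>G\<^esub> v" if "u \<in> verts G" "v \<in> verts G" for u v
    using symmetric_connected_imp_strongly_connected[OF sym_arcs assms(3)] that by blast
  have dist: "graph_dist G u v = ereal (real (?d u v))" if "u \<in> verts G" "v \<in> verts G" for u v
    using graph_dist_eq_Least reach that by blast
  interpret nat_geodesic_space "verts G" ?d
  proof (rule nat_geodesic_space_relpow)
    show "sym (arcs_ends G)" using sym_arcs by (simp add: symmetric_def)
  qed (auto intro: reachable_rtranclI reach adj_in_verts)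
  have no_isolated: "\<exists>w. v \<rightarrow>\<^bsub>G\<^esub> w" if v: "v \<in> verts G" for v
  proof -
    have "verts G \<noteq> {v}" using assms(4) by auto
    then obtain w where "w \<in> verts G" "w \<noteq> v" using v by blast
    \<comment> \<open>The first arc of a walk from \<open>v\<close> to \<open>w\<close> leaves
      \<open>v\<close>.\<close>
    then show ?thesis using reach[OF v, of w] by (auto elim: converse_reachable_cases)
  qed
  obtain S where S: "total_dominating_set k G S" "card S = total_domination_number k G"
    using total_domination_number_attained[OF assms(1) no_isolated] by metis
  have SV: "S \<subseteq> verts G" using S(1) by (simp add: total_dominating_set_def)
  then have fin: "finite S" by (rule finite_subset) simp
  have dom: "\<exists>s\<in>S - {v}. ?d v s \<le> k" if v: "v \<in> verts G" for v
  proof -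
    let ?D = "graph_dist G v ` (S - {v})"
    have le: "Inf ?D \<le> ereal (real k)"
      using S(1) v by (simp add: total_dominating_set_def dist_to_set_def)
    \<comment> \<open>An empty infimum would be \<open>\<infinity>\<close>. Being finite and
      nonempty, \<open>?D\<close> attains its infimum at an actual dominating vertex.\<close>
    then have "?D \<noteq> {}" by (intro notI) (simp add: top_ereal_def)
    then have "Inf ?D \<in> ?D" using fin Min_in[of ?D] cInf_eq_Min[of ?D] by (metis finite_Diff finite_imageI)
    then obtain s where "s \<in> S - {v}" "Inf ?D = graph_dist G v s" by blast
    then show ?thesis using le dist[of v s] v SV by (intro bexI[of _ s]) auto
  qed
  have ne: "verts G \<noteq> {}" using assms(4) by auto
  obtain c where c: "c \<in> verts G" "\<And>v. v \<in> verts G \<Longrightarrow> ?d c v \<le> k * card S"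
    using total_dominating_set_ball[OF fin SV ne assms(1) dom] by blast
  have "radius G \<le> eccentricity G c"
    unfolding radius_def using c(1) by (rule INF_lower)
  also have "\<dots> \<le> ereal (real (k * card S))"
    unfolding eccentricity_def by (rule SUP_least) (use c dist in \<open>simp del: of_nat_mult\<close>)
  finally have "ereal (1 / real k) * radius G \<le> ereal (1 / real k) * ereal (real (k * card S))"
    by (rule ereal_mult_left_mono) simp
  also have "\<dots> = ereal (real (card S))" using assms(1) by simp
  finally show ?thesis by (simp add: S(2))
qed

end
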